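(* Let $d\in\mathbb{N}$, let $H$ be a finite-dimensional Hilbert space, and let $K,L:\mathbb{F}_d^+\times\mathbb{F}_d^+\to\mathcal{L}(H)$ be moment kernels with $K(\emptyset,\emptyset)=L(\emptyset,\emptyset)=I_H$ and first defects satisfying $K^{(1)}=K-\Sigma K\ge0$ and $L^{(1)}=L-\Sigma L\ge0$. (1) If $0\le L\le K$, then $\kappa(L)\le\kappa(K)$. (2) If $U:H\to H$ is unitary and $K^U(\alpha,\beta)=U^*K(\alpha,\beta)U$, then $\kappa(K^U)=\kappa(K)$. (3) If $V:H\to H'$ is an isometry into a Hilbert space $H'$ and $K'(\alpha,\beta)=VK(\alpha,\beta)V^*$, then $\kappa(K')=\kappa(K)$.
   Context: $\mathbb{F}_d^+$ is the free semigroup on $\{1,\dots,d\}$ with neutral element $\emptyset$. A moment kernel is a kernel $K(\alpha,\beta)=\mathbb{E}[A^\alpha(A^\beta)^*]$ for a $d$-tuple $A=(A_1,\dots,A_d)$ of strongly measurable random operators $A_i:\Omega\to\mathcal{L}(H)$ over a probability space with $\mathbb{E}[\|A^\alpha\|^2]<\infty$ for all $\alpha$, where $A^\alpha=A_{i_1}\cdots A_{i_k}$ for $\alpha=i_1\cdots i_k$ and $A^\emptyset=I$. A kernel $K$ is positive definite, written $K\ge0$, if $\sum_{i,j}\langle u_i,K(\alpha_i,\alpha_j)u_j\rangle\ge0$ for every finite family $\{(\alpha_j,u_j)\}\subset\mathbb{F}_d^+\times H$; $L\le K$ means $K-L\ge0$. The free shift is $(\Sigma K)(\alpha,\beta):=\sum_{i=1}^dK(\alpha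 i,\beta i)$. The curvature is $\kappa(K):=\lim_{N\to\infty}\mathrm{tr}((\Sigma^NK)(\emptyset,\emptyset))$; the same formula is used to define $\kappa(K^U)$ and $\kappa(K')$ (in the latter case with the trace on $H'$). *)

theory Defs
  imports "HOL-Analysis.Analysis" "HOL-Probability.Probability_Measure" "HOL-Library.Complex_Order"
begin

section \<open>Complex Hilbert spaces\<close>

class scaleC =
  fixes scaleC :: "complex \<Rightarrow> 'a \<Rightarrow> 'a" (infixr "*\<^sub>C" 75)

text \<open>
  The complex inner product is conjugate-linear in its first argument. The real inner product
  inherited from \<^class>\<open>real_inner\<close> is its real part, so the norm of the class is the Hilbert norm.
\<close>

class chilbert_space = real_inner + complete_space + scaleC +
  fixes cinner :: "'a \<Rightarrow> 'a \<Rightarrow> complex"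
  assumes scaleC_add_right: "a *\<^sub>C (x + y) = a *\<^sub>C x + a *\<^sub>C y"
    and scaleC_add_left: "(a + b) *\<^sub>C x = a *\<^sub>C x + b *\<^sub>C x"
    and scaleC_scaleC: "a *\<^sub>C (b *\<^sub>C x) = (a * b) *\<^sub>C x"
    and scaleR_scaleC: "r *\<^sub>R x = complex_of_real r *\<^sub>C x"
    and cinner_commute: "cinner x y = cnj (cinner y x)"
    and cinner_add_right: "cinner x (y + z) = cinner x y + cinner x z"
    and cinner_scaleC_right: "cinner x (a *\<^sub>C y) = a * cinner x y"
    and inner_eq_Re_cinner: "inner x y = Re (cinner x y)"

instantiation complex :: chilbert_space
begin

definition scaleC_complex :: "complex \<Rightarrow> complex \<Rightarrow> complex" where
  "scaleC_complex a x = a * x"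

definition cinner_complex :: "complex \<Rightarrow> complex \<Rightarrow> complex" where
  "cinner_complex x y = cnj x * y"

instance
  by standard
    (simp_all add: scaleC_complex_def cinner_complex_def algebra_simps scaleR_conv_of_real
      inner_complex_def)

end

interpretation cvec: vector_space "scaleC :: complex \<Rightarrow> 'a \<Rightarrow> 'a::chilbert_space"
proof
  fix x :: 'a
  show "1 *\<^sub>C x = x"
    using scaleR_scaleC[of 1 x] by simp
qed (simp_all add: scaleC_add_right scaleC_add_left scaleC_scaleC)

definition orthonormal_basis :: "'a::chilbert_space set \<Rightarrow> bool" where
  "orthonormal_basis B \<longleftrightarrow>
     (\<forall>x\<in>B. norm x = 1) \<and> (\<forall>x\<in>B. \<forall>y\<in>B. x \<noteq> y \<longrightarrow> cinner x y = 0) \<and>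
     closure (cvec.span B) = UNIV"

section \<open>Operators\<close>

text \<open>
  The type of bounded operators in the library consists of the real-linear ones; the elements of
  \<open>\<L>(H)\<close> are those that satisfy the following predicate.
\<close>

definition complex_linear :: "('a::chilbert_space \<Rightarrow>\<^sub>L 'b::chilbert_space) \<Rightarrow> bool" where
  "complex_linear T \<longleftrightarrow> (\<forall>c x. T (c *\<^sub>C x) = c *\<^sub>C T x)"

definition adj :: "('a::chilbert_space \<Rightarrow>\<^sub>L 'b::chilbert_space) \<Rightarrow> ('b \<Rightarrow>\<^sub>L 'a)" where
  "adj T = (THE S :: 'b \<Rightarrow>\<^sub>L 'a. \<forall>x y. cinner (S x) y = cinner x (T y))"

definition unitary_op :: "('a::chilbert_space \<Rightarrow>\<^sub>L 'a) \<Rightarrow> bool" where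
  "unitary_op U \<longleftrightarrow> complex_linear U \<and> adj U o\<^sub>L U = id_blinfun \<and> U o\<^sub>L adj U = id_blinfun"

definition isometry_op :: "('a::chilbert_space \<Rightarrow>\<^sub>L 'b::chilbert_space) \<Rightarrow> bool" where
  "isometry_op V \<longleftrightarrow> complex_linear V \<and> (\<forall>x. norm (V x) = norm x)"

text \<open>For a trace class operator the sum does not depend on the choice of the basis.\<close>

definition trace_op :: "('a::chilbert_space \<Rightarrow>\<^sub>L 'a) \<Rightarrow> complex" where
  "trace_op T = (\<Sum>\<^sub>\<infinity>e\<in>(SOME B. orthonormal_basis B). cinner e (T e))"

section \<open>Operator-valued kernels on the free semigroup\<close>

definition words :: "nat \<Rightarrow> nat list set" where
  "words d = lists {1..d}"

text \<open>Only the values of a kernel on \<^term>\<open>words d \<times> words d\<close> matter.\<close>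

type_synonym 'h kernel = "nat list \<Rightarrow> nat list \<Rightarrow> 'h \<Rightarrow>\<^sub>L 'h"

definition pos_def :: "nat \<Rightarrow> 'h::chilbert_space kernel \<Rightarrow> bool" where
  "pos_def d K \<longleftrightarrow>
     (\<forall>(n::nat) (\<alpha> :: nat \<Rightarrow> nat list) (u :: nat \<Rightarrow> 'h).
        (\<forall>i<n. \<alpha> i \<in> words d) \<longrightarrow>
        0 \<le> (\<Sum>i<n. \<Sum>j<n. cinner (u i) (K (\<alpha> i) (\<alpha> j) (u j))))"

definition kernel_le :: "nat \<Rightarrow> 'h::chilbert_space kernel \<Rightarrow> 'h kernel \<Rightarrow> bool" where
  "kernel_le d L K \<longleftrightarrow> pos_def d (\<lambda>\<alpha> \<beta>. K \<alpha> \<beta> - L \<alpha> \<beta>)"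

definition free_shift :: "nat \<Rightarrow> 'h::chilbert_space kernel \<Rightarrow> 'h kernel" where
  "free_shift d K = (\<lambda>\<alpha> \<beta>. \<Sum>i=1..d. K (\<alpha> @ [i]) (\<beta> @ [i]))"

definition first_defect :: "nat \<Rightarrow> 'h::chilbert_space kernel \<Rightarrow> 'h kernel" where
  "first_defect d K = (\<lambda>\<alpha> \<beta>. K \<alpha> \<beta> - free_shift d K \<alpha> \<beta>)"

fun word_op :: "(nat \<Rightarrow> 'h \<Rightarrow>\<^sub>L 'h) \<Rightarrow> nat list \<Rightarrow> 'h::chilbert_space \<Rightarrow>\<^sub>L 'h" where
  "word_op A [] = id_blinfun"
| "word_op A (i # \<alpha>) = A i o\<^sub>L word_op A \<alpha>"

text \<open>
  A random operator is measurable in the strong operator sense, so the operator-valued expectation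
  \<open>\<bbbE>[A\<^sup>\<alpha> (A\<^sup>\<beta>)\<^sup>*]\<close> is the weak integral, given by its sesquilinear form; in finite dimension it
  coincides with the Bochner integral in operator norm.
\<close>

definition random_tuple :: "nat \<Rightarrow> 'w measure \<Rightarrow> (nat \<Rightarrow> 'w \<Rightarrow> 'h::chilbert_space \<Rightarrow>\<^sub>L 'h) \<Rightarrow> bool" where
  "random_tuple d M A \<longleftrightarrow>
     (\<forall>i\<in>{1..d}. (\<forall>\<omega>\<in>space M. complex_linear (A i \<omega>)) \<and>
                  (\<forall>h. (\<lambda>\<omega>. A i \<omega> h) \<in> borel_measurable M)) \<and>
     (\<forall>\<alpha>\<in>words d. (\<integral>\<^sup>+\<omega>. ennreal ((norm (word_op (\<lambda>i. A i \<omega>) \<alpha>))\<^sup>2) \<partial>M) < \<infinity>)"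

definition moment_kernel :: "nat \<Rightarrow> 'w measure \<Rightarrow> 'h::chilbert_space kernel \<Rightarrow> bool" where
  "moment_kernel d M K \<longleftrightarrow>
     prob_space M \<and>
     (\<forall>\<alpha>\<in>words d. \<forall>\<beta>\<in>words d. complex_linear (K \<alpha> \<beta>)) \<and>
     (\<exists>A. random_tuple d M A \<and>
        (\<forall>\<alpha>\<in>words d. \<forall>\<beta>\<in>words d. \<forall>u v.
           has_bochner_integral M
             (\<lambda>\<omega>. cinner u ((word_op (\<lambda>i. A i \<omega>) \<alpha> o\<^sub>L adj (word_op (\<lambda>i. A i \<omega>) \<beta>)) v))
             (cinner u (K \<alpha> \<beta> v))))"

section \<open>Curvature\<close>

definition curvature_seq :: "nat \<Rightarrow> 'h::chilbert_space kernel \<Rightarrow> nat \<Rightarrow> complex" where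
  "curvature_seq d K N = trace_op ((free_shift d ^^ N) K [] [])"

text \<open>
  The curvature is kept as a complex number: the order of \<^theory>\<open>HOL-Library.Complex_Order\<close>
  compares real parts and requires equal imaginary parts.
\<close>

definition curvature :: "nat \<Rightarrow> 'h::chilbert_space kernel \<Rightarrow> complex" where
  "curvature d K = lim (curvature_seq d K)"

end

theory Submission
  imports Defs
begin

text \<open>
  The free shift preserves positivity of the diagonal values \<open>K(\<alpha>, \<alpha>)\<close>, and applying it \<open>N\<close> times
  to the first defect gives the difference of two consecutive iterates. Hence the traces
  decrease in \<open>N\<close>; they are nonnegative because \<open>K(\<alpha>, \<alpha>)\<close> is an expectation of operators
  \<open>A A\<^sup>*\<close>. For an isometry \<open>V\<close> the trace of \<open>V T V\<^sup>*\<close> equals that of \<open>T\<close> by Parseval's identity, and the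
  unitary case is the isometry \<open>V = U\<^sup>*\<close>.
\<close>

section \<open>Orthonormal bases\<close>

text \<open>Nearest-point argument: the parallelogram law makes a minimizing sequence Cauchy,
  completeness gives its limit \<open>p\<close>, and minimality makes the residual
  \<open>x - p\<close> orthogonal to the subspace. Real scalars suffice here; complex orthogonality
  is recovered where the lemma is applied.\<close>

lemma closure_subspace_orthogonal:
  fixes S :: "'a::{real_inner, complete_space} set"
  assumes S: "subspace S" and ne: "closure S \<noteq> UNIV"
  obtains w where "w \<noteq> 0" "\<And>v. v \<in> S \<Longrightarrow> inner w v = 0"
proof -
  obtain x where x: "x \<notin> closure S" using ne by auto
  define r where "r = infdist x S"
  have S0: "S \<noteq> {}" using subspace_0[OF S] by auto
  have r0: "r \<ge> 0" by (simp add: r_def infdist_nonneg)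
  have lb: "r \<le> norm (x - y)" if "y \<in> S" for y
    using infdist_le[OF that, of x] by (simp add: r_def dist_norm)
  have lb2: "r\<^sup>2 \<le> (norm (x - y))\<^sup>2" if "y \<in> S" for y
    using lb[OF that] r0 by (intro power_mono)
  \<comment> \<open>The error is measured on squared distances, so that the terms
    \<open>r\<^sup>2\<close> cancel exactly in the parallelogram estimate and only 4 / (N + 1)
    remains.\<close>
  have "\<exists>y\<in>S. (norm (x - y))\<^sup>2 < r\<^sup>2 + 1 / real (Suc n)" for n
  proof -
    have "r < sqrt (r\<^sup>2 + 1 / real (Suc n))"
      by (rule real_less_rsqrt) simp
    then obtain y where "y \<in> S" "dist x y < sqrt (r\<^sup>2 + 1 / real (Suc n))"
      using cInf_lessD[of "dist x ` S"] S0 by (auto simp: r_def infdist_def)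
    moreover from this have "(norm (x - y))\<^sup>2 < (sqrt (r\<^sup>2 + 1 / real (Suc n)))\<^sup>2"
      by (intro power_strict_mono) (auto simp: dist_norm)
    ultimately show ?thesis by (auto simp: real_sqrt_pow2)
  qed
  then obtain y where yS: "\<And>n. y n \<in> S"
    and y: "\<And>n. (norm (x - y n))\<^sup>2 < r\<^sup>2 + 1 / real (Suc n)" by metis
  \<comment> \<open>Parallelogram law for \<open>x - a\<close> and \<open>x - b\<close>: the
    midpoint of \<open>a\<close> and \<open>b\<close> lies in \<open>S\<close>, hence at distance at
    least \<open>r\<close> from \<open>x\<close>.\<close>
  have par: "(norm (a - b))\<^sup>2 \<le> 2 * (norm (x - a))\<^sup>2 + 2 * (norm (x - b))\<^sup>2 - 4 * r\<^sup>2"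
    if "a \<in> S" "b \<in> S" for a b
  proof -
    have "(1/2) *\<^sub>R (a + b) \<in> S"
      using S that by (intro subspace_scale subspace_add)
    then have "r\<^sup>2 \<le> (norm (x - (1/2) *\<^sub>R (a + b)))\<^sup>2" by (rule lb2)
    moreover have "(norm (a - b))\<^sup>2 =
        2 * (norm (x - a))\<^sup>2 + 2 * (norm (x - b))\<^sup>2 - 4 * (norm (x - (1/2) *\<^sub>R (a + b)))\<^sup>2"
      by (simp add: power2_norm_eq_inner inner_simps inner_commute algebra_simps)
    ultimately show ?thesis by linarith
  qed
  have "Cauchy y"
  proof (rule metric_CauchyI)
    fix e :: real assume e: "0 < e"
    obtain N where N: "1 / real (Suc N) < e\<^sup>2 / 4"
      using e nat_approx_posE[of "e\<^sup>2 / 4"] by (metis zero_less_power divide_pos_pos zero_less_numeral)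
    have "dist (y m) (y n) < e" if "m \<ge> N" "n \<ge> N" for m n
    proof -
      have "1 / real (Suc m) \<le> 1 / real (Suc N)" "1 / real (Suc n) \<le> 1 / real (Suc N)"
        using that by (auto intro!: divide_left_mono)
      then have "(norm (y m - y n))\<^sup>2 < e\<^sup>2"
        using par[OF yS yS, of m n] y[of m] y[of n] N by linarith
      then show ?thesis using e power_less_imp_less_base[of "norm (y m - y n)" 2 e]
        by (simp add: dist_norm)
    qed
    then show "\<exists>M. \<forall>m\<ge>M. \<forall>n\<ge>M. dist (y m) (y n) < e" by blast
  qed
  then obtain p where p: "y \<longlonglongrightarrow> p" using Cauchy_convergent convergent_def by blast
  define w where "w = x - p" \<comment> \<open>\<open>p\<close> is the point of the closed subspace nearest to \<open>x\<close>\<close>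
  have "p \<in> closure S" using p yS by (auto simp: closure_sequential)
  then have "w \<noteq> 0" using x by (auto simp: w_def)
  have "(\<lambda>n. r\<^sup>2 + 1 / real (Suc n)) \<longlonglongrightarrow> r\<^sup>2 + 0"
    by (intro tendsto_intros LIMSEQ_Suc[OF lim_1_over_n])
  moreover have "(\<lambda>n. (norm (x - y n))\<^sup>2) \<longlonglongrightarrow> (norm w)\<^sup>2"
    unfolding w_def by (intro tendsto_intros p)
  ultimately have "(norm w)\<^sup>2 \<le> r\<^sup>2 + 0"
    using y by (intro LIMSEQ_le) (auto intro!: exI[of _ 0] less_imp_le)
  then have nw: "(norm w)\<^sup>2 \<le> r\<^sup>2" by simp
  have min: "(norm w)\<^sup>2 \<le> (norm (w - v))\<^sup>2" if v: "v \<in> S" for v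
  proof -
    have "(\<lambda>n. (norm (x - (y n + v)))\<^sup>2) \<longlonglongrightarrow> (norm (x - (p + v)))\<^sup>2"
      by (intro tendsto_intros p)
    moreover have "r\<^sup>2 \<le> (norm (x - (y n + v)))\<^sup>2" for n
      using yS v S by (intro lb2 subspace_add)
    ultimately have "r\<^sup>2 \<le> (norm (x - (p + v)))\<^sup>2"
      by (intro LIMSEQ_le_const) auto
    then have "r\<^sup>2 \<le> (norm (w - v))\<^sup>2" by (simp add: w_def diff_diff_eq)
    then show ?thesis using nw by linarith
  qed
  have "inner w v = 0" if v: "v \<in> S" for v
  proof (cases "v = 0")
    case False
    \<comment> \<open>This is the real coefficient minimizing the norm of
      \<open>w - t *\<^sub>R v\<close>; a nonzero \<open>inner w v\<close> would make that norm
      smaller than the minimum.\<close>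
    define t where "t = inner w v / inner v v"
    have vv: "inner v v > 0" using False by simp
    have "(norm w)\<^sup>2 \<le> (norm (w - t *\<^sub>R v))\<^sup>2"
      using v S by (intro min subspace_scale)
    also have "\<dots> = (norm w)\<^sup>2 - 2 * t * inner w v + t\<^sup>2 * inner v v"
      unfolding power2_norm_eq_inner
      by (simp add: inner_simps inner_commute algebra_simps power2_eq_square)
    also have "\<dots> = (norm w)\<^sup>2 - (inner w v)\<^sup>2 / inner v v"
      using vv by (simp add: t_def field_simps power2_eq_square)
    finally have "(inner w v)\<^sup>2 / inner v v \<le> 0" by simp
    then show ?thesis using vv by (simp add: divide_le_0_iff)
  qed simp
  with \<open>w \<noteq> 0\<close> that show thesis by blast
qed

section \<open>Calculus of the complex inner product\<close>

lemma cinner_add_left: "cinner (x + y) z = cinner x z + cinner y z"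
  by (metis cinner_add_right cinner_commute complex_cnj_add)

lemma cinner_scaleC_left: "cinner (a *\<^sub>C x) y = cnj a * cinner x y"
  by (metis cinner_scaleC_right cinner_commute complex_cnj_mult)

text \<open>Conjugate-linearity in the first argument turns the imaginary part into a real inner
  product with \<open>\<i> *\<^sub>C x\<close>. Boundedness, orthogonality and invariance under
  isometries thus carry over from \<open>inner\<close> to \<open>cinner\<close>.\<close>

lemma cinner_eq_Complex: "cinner x y = Complex (inner x y) (inner (\<i> *\<^sub>C x) y)"
  by (simp add: complex_eq_iff inner_eq_Re_cinner cinner_scaleC_left)

lemma cinner_self: "cinner x x = complex_of_real ((norm x)\<^sup>2)"
  using cinner_commute[of x x]
  by (simp add: complex_eq_iff power2_norm_eq_inner inner_eq_Re_cinner)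

lemma bounded_linear_cinner_right: "bounded_linear (cinner x)"
proof -
  have "cinner x = (\<lambda>y. complex_of_real (inner x y) + \<i> * complex_of_real (inner (\<i> *\<^sub>C x) y))"
    by (simp add: fun_eq_iff cinner_eq_Complex complex_eq_iff)
  then show ?thesis
    by (auto intro!: bounded_linear_add bounded_linear_of_real[THEN bounded_linear_compose]
        bounded_linear_inner_right bounded_linear_mult_right[THEN bounded_linear_compose])
qed

lemma cinner_zero_right [simp]: "cinner x 0 = 0"
  by (rule linear_simps(3)[OF bounded_linear_cinner_right])

lemma cinner_zero_left [simp]: "cinner 0 x = 0"
  by (metis cinner_commute cinner_zero_right complex_cnj_zero)

lemma cinner_diff_right: "cinner x (y - z) = cinner x y - cinner x z"
  by (rule linear_simps(2)[OF bounded_linear_cinner_right])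

lemma cinner_sum_right: "cinner x (\<Sum>i\<in>I. f i) = (\<Sum>i\<in>I. cinner x (f i))"
  by (rule linear_sum[OF bounded_linear.linear[OF bounded_linear_cinner_right]])

lemma cinner_sum_left: "cinner (\<Sum>i\<in>I. f i) x = (\<Sum>i\<in>I. cinner (f i) x)"
  by (induction I rule: infinite_finite_induct) (auto simp: cinner_add_left)

lemma cinner_left_eqI:
  fixes x y :: "'a::chilbert_space"
  assumes "\<And>z. cinner x z = cinner y z"
  shows "x = y"
proof -
  have "inner x (x - y) = inner y (x - y)"
    using assms by (simp add: inner_eq_Re_cinner)
  then have "inner (x - y) (x - y) = 0"
    by (simp add: inner_diff_left)
  then show ?thesis by simp
qed

lemma norm_scaleC: "norm (c *\<^sub>C x) = cmod c * norm (x :: 'a::chilbert_space)"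
proof -
  have "complex_of_real ((norm (c *\<^sub>C x))\<^sup>2) = (c * cnj c) * complex_of_real ((norm x)\<^sup>2)"
    unfolding cinner_self[symmetric] by (simp add: cinner_scaleC_left cinner_scaleC_right)
  also have "\<dots> = complex_of_real ((cmod c * norm x)\<^sup>2)"
    by (simp only: complex_norm_square[symmetric] of_real_mult[symmetric] power_mult_distrib)
  finally have "(norm (c *\<^sub>C x))\<^sup>2 = (cmod c * norm x)\<^sup>2"
    unfolding of_real_eq_iff .
  then show ?thesis by (rule power2_eq_imp_eq) auto
qed

lemma bounded_linear_scaleC_left: "bounded_linear (\<lambda>c. c *\<^sub>C (x :: 'a::chilbert_space))"
  by (rule bounded_linear_intro[where K = "norm x"])
    (auto simp: scaleC_add_left scaleR_scaleC[where 'a = 'a] scaleC_scaleC norm_scaleC scaleR_conv_of_real)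

section \<open>Orthonormal sets, existence of bases and Parseval's identity\<close>

definition orthonormal :: "'a::chilbert_space set \<Rightarrow> bool" where
  "orthonormal B \<longleftrightarrow> (\<forall>x\<in>B. \<forall>y\<in>B. cinner x y = (if x = y then 1 else 0))"

lemma orthonormal_basis_iff:
  "orthonormal_basis B \<longleftrightarrow> orthonormal B \<and> closure (cvec.span B) = UNIV"
proof -
  have "norm x = 1 \<longleftrightarrow> cinner x x = 1" for x :: 'a
    unfolding cinner_self of_real_eq_1_iff by (simp add: abs_square_eq_1)
  then show ?thesis unfolding orthonormal_basis_def orthonormal_def by metis
qed

lemma subspace_cspan: "subspace (cvec.span B)"
  by (auto simp: subspace_def scaleR_scaleC cvec.span_zero intro: cvec.span_add cvec.span_scale)

text \<open>Zorn's lemma yields a maximal orthonormal set; were its span not dense, a normalized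
  orthogonal vector could be added. No dimension is assumed, because \<open>trace_op\<close> also
  chooses a basis in the codomain of the isometry, which may be infinite-dimensional.\<close>

lemma orthonormal_basis_exists: "\<exists>B :: 'a::chilbert_space set. orthonormal_basis B"
proof -
  have "\<exists>M\<in>{B :: 'a set. orthonormal B}. \<forall>X\<in>{B. orthonormal B}. M \<subseteq> X \<longrightarrow> X = M"
  proof (rule subset_Zorn')
    fix C assume C: "subset.chain {B :: 'a set. orthonormal B} C"
    show "\<Union>C \<in> {B. orthonormal B}"
      unfolding orthonormal_def mem_Collect_eq
    proof (intro ballI)
      fix x y assume "x \<in> \<Union>C" "y \<in> \<Union>C"
      then obtain X Y where XY: "X \<in> C" "x \<in> X" "Y \<in> C" "y \<in> Y" by blast
      then have "X \<subseteq> Y \<or> Y \<subseteq> X" using C by (auto simp: subset_chain_def)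
      then obtain Z where "Z \<in> C" "x \<in> Z" "y \<in> Z" using XY by blast
      then show "cinner x y = (if x = y then 1 else 0)"
        using C by (auto simp: subset_chain_def orthonormal_def)
    qed
  qed
  then obtain B :: "'a set" where B: "orthonormal B"
    and maxi: "\<And>X. orthonormal X \<Longrightarrow> B \<subseteq> X \<Longrightarrow> X = B" by auto
  have "closure (cvec.span B) = UNIV"
  proof (rule ccontr)
    assume "closure (cvec.span B) \<noteq> UNIV"
    then obtain w where w0: "w \<noteq> 0" and w: "\<And>v. v \<in> cvec.span B \<Longrightarrow> inner w v = 0"
      using closure_subspace_orthogonal[OF subspace_cspan] by metis
    \<comment> \<open>The complex span contains \<open>\<i> *\<^sub>C v\<close> along with
      \<open>v\<close>, so real orthogonality to both kills the imaginary part too.\<close>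
    have cw: "cinner v w = 0" if "v \<in> B" for v
      using w[of v] w[of "\<i> *\<^sub>C v"] that
      by (auto simp: cinner_eq_Complex inner_commute complex_eq_iff
          intro: cvec.span_base cvec.span_scale)
    define u where "u = complex_of_real (inverse (norm w)) *\<^sub>C w"
    have "cinner u u = 1"
      unfolding cinner_self u_def norm_scaleC norm_of_real using w0 by simp
    moreover have bu: "cinner v u = 0" "cinner u v = 0" if "v \<in> B" for v
      using cw[OF that] cinner_commute[of w v] that
      by (auto simp: u_def cinner_scaleC_right cinner_scaleC_left)
    ultimately have "orthonormal (insert u B)"
      using B by (auto simp: orthonormal_def)
    then have "u \<in> B" using maxi by blast
    then show False using bu[of u] \<open>cinner u u = 1\<close> by auto
  qed
  with B show ?thesis by (auto simp: orthonormal_basis_iff)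
qed

text \<open>A name for the very choice made inside \<open>trace_op\<close>.\<close>

definition basis :: "'a::chilbert_space set" where
  "basis = (SOME B. orthonormal_basis B)"

lemma orthonormal_basis_basis: "orthonormal_basis basis"
  unfolding basis_def using orthonormal_basis_exists by (rule someI_ex)

text \<open>A finite combination \<open>z\<close> of basis vectors approximates \<open>x\<close>
  within \<epsilon>. For every finite \<open>G\<close> containing the support of \<open>z\<close>,
  the partial sum over \<open>G\<close> is the orthogonal projection of \<open>x\<close> onto the
  span of \<open>G\<close>, hence at least as close to \<open>x\<close> as \<open>z\<close>.\<close>

lemma orthonormal_basis_expansion:
  fixes x :: "'a::chilbert_space"
  assumes "orthonormal_basis B"
  shows "((\<lambda>e. cinner e x *\<^sub>C e) has_sum x) B"
  unfolding has_sum_def tendsto_iff eventually_finite_subsets_at_top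
proof (intro allI impI)
  have B: "orthonormal B" and dense: "closure (cvec.span B) = UNIV"
    using assms by (auto simp: orthonormal_basis_iff)
  fix \<epsilon> :: real assume "0 < \<epsilon>"
  then obtain z where z: "z \<in> cvec.span B" "dist z x < \<epsilon>"
    using dense closure_approachable[of x "cvec.span B"] by auto
  then obtain F c where F: "finite F" "F \<subseteq> B" and zF: "z = (\<Sum>e\<in>F. c e *\<^sub>C e)"
    by (auto simp: cvec.span_explicit)
  have "dist (\<Sum>e\<in>G. cinner e x *\<^sub>C e) x < \<epsilon>" if G: "finite G" "G \<subseteq> B" "F \<subseteq> G" for G
  proof -
    define p where "p = (\<Sum>e\<in>G. cinner e x *\<^sub>C e)"
    have orth: "cinner e (x - p) = 0" if "e \<in> G" for e
    proof -
      have "cinner e p = (\<Sum>f\<in>G. cinner f x * (if e = f then 1 else 0))"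
        unfolding p_def cinner_sum_right cinner_scaleC_right
        using B G(2) that by (intro sum.cong) (auto simp: orthonormal_def subset_iff)
      also have "\<dots> = cinner e x" using G that by (simp add: if_distrib cong: if_cong)
      finally show ?thesis by (simp add: cinner_diff_right)
    qed
    \<comment> \<open>Together with \<open>orth\<close> this makes \<open>p - z\<close> orthogonal
      to \<open>x - p\<close>, and Pythagoras applies to \<open>x - z\<close>.\<close>
    have "p - z \<in> cvec.span G"
      unfolding p_def zF using G
      by (intro cvec.span_diff cvec.span_sum cvec.span_scale cvec.span_base) auto
    then obtain c' where "p - z = (\<Sum>e\<in>G. c' e *\<^sub>C e)"
      using G by (auto simp: cvec.span_finite)
    then have "cinner (p - z) (x - p) = 0"
      by (simp add: cinner_sum_left cinner_scaleC_left orth)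
    then have *: "inner (p - z) (x - p) = 0" by (simp add: inner_eq_Re_cinner)
    have "(norm (x - z))\<^sup>2 = (norm (x - p))\<^sup>2 + (norm (p - z))\<^sup>2"
    proof -
      have "(norm ((x - p) + (p - z)))\<^sup>2 = (norm (x - p))\<^sup>2 + (norm (p - z))\<^sup>2"
        unfolding power2_norm_eq_inner inner_add_left inner_add_right
        using * by (simp only: inner_commute[of "x - p" "p - z"])
      then show ?thesis by simp
    qed
    then have "(norm (x - p))\<^sup>2 \<le> (norm (x - z))\<^sup>2" by simp
    then have "norm (x - p) \<le> norm (x - z)" by (rule power2_le_imp_le) simp
    then show ?thesis using z(2) by (simp add: p_def dist_norm norm_minus_commute)
  qed
  with F show "\<exists>X. finite X \<and> X \<subseteq> B \<and>
      (\<forall>Y. finite Y \<and> X \<subseteq> Y \<and> Y \<subseteq> B \<longrightarrow> dist (\<Sum>e\<in>Y. cinner e x *\<^sub>C e) x < \<epsilon>)" by blast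
qed

lemma parseval:
  assumes "orthonormal_basis B"
  shows "((\<lambda>e. cinner y e * cinner e x) has_sum cinner y x) B"
  using has_sum_bounded_linear[OF bounded_linear_cinner_right orthonormal_basis_expansion[OF assms], of y x]
  by (simp add: o_def cinner_scaleC_right mult.commute)

lemma has_sum_sum:
  fixes f :: "'i \<Rightarrow> 'a \<Rightarrow> 'b::topological_comm_monoid_add"
  assumes "\<And>i. i \<in> I \<Longrightarrow> (f i has_sum s i) A"
  shows "((\<lambda>x. \<Sum>i\<in>I. f i x) has_sum (\<Sum>i\<in>I. s i)) A"
  using assms by (induction I rule: infinite_finite_induct) (auto intro: has_sum_add)

text \<open>Orthonormal sets are linearly independent, so a finite spanning set bounds their
  size.\<close>

lemma orthonormal_finite:
  fixes B :: "'a::chilbert_space set"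
  assumes "\<exists>S :: 'a set. finite S \<and> cvec.span S = UNIV" and B: "orthonormal B"
  shows "finite B"
proof -
  have "\<not> cvec.dependent B"
  proof
    assume "cvec.dependent B"
    then obtain F c v where F: "finite F" "F \<subseteq> B" "(\<Sum>e\<in>F. c e *\<^sub>C e) = 0" "v \<in> F" "c v \<noteq> 0"
      by (auto simp: cvec.dependent_explicit)
    have "cinner v (\<Sum>e\<in>F. c e *\<^sub>C e) = (\<Sum>e\<in>F. c e * (if v = e then 1 else 0))"
      unfolding cinner_sum_right cinner_scaleC_right
      using B F(2,4) by (intro sum.cong) (auto simp: orthonormal_def subset_iff)
    also have "\<dots> = c v" using F by (simp add: if_distrib cong: if_cong)
    finally show False using F by simp
  qed
  then show ?thesis using assms(1) cvec.independent_span_bound by (metis top_greatest)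
qed

section \<open>Adjoints and traces in finite dimension\<close>

text \<open>Finite dimension is a property of the type \<open>'h\<close>, passed through an
  \<open>itself\<close> parameter. Other spaces, such as the codomain of an isometry, stay
  arbitrary.\<close>

locale finite_dim_hilbert =
  fixes T :: "'h::chilbert_space itself"
  assumes finite_spanning: "\<exists>S :: 'h set. finite S \<and> cvec.span S = UNIV"
begin

lemma finite_basis: "finite (basis :: 'h set)"
  using orthonormal_finite[OF finite_spanning] orthonormal_basis_basis
  by (auto simp: orthonormal_basis_iff)

lemma basis_expansion: "(\<Sum>e\<in>basis. cinner e x *\<^sub>C e) = (x :: 'h)"
  using orthonormal_basis_expansion[OF orthonormal_basis_basis, of x] finite_basis
  by (metis has_sum_finite has_sum_unique)

lemma parseval_finite: "(\<Sum>e\<in>basis. cinner y e * cinner e x) = cinner y (x :: 'h)"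
  using parseval[OF orthonormal_basis_basis, of y x] finite_basis
  by (metis has_sum_finite has_sum_unique)

lemma trace_op_eq: "trace_op S = (\<Sum>e\<in>(basis :: 'h set). cinner e (S e))"
  unfolding trace_op_def basis_def[symmetric] using finite_basis by simp

text \<open>Since \<open>adj\<close> is a definite description, an adjoint has to be exhibited and
  shown unique. The witness \<open>R\<close> has coordinates \<open>cinner (S e) y\<close> in the
  finite basis of the domain, as the adjoint identity forces; uniqueness is
  \<open>cinner_left_eqI\<close>.\<close>

lemma cinner_adj_left:
  fixes S :: "'h \<Rightarrow>\<^sub>L 'k::chilbert_space"
  assumes "complex_linear S"
  shows "cinner (adj S y) x = cinner y (S x)"
proof -
  define R where "R = Blinfun (\<lambda>y. \<Sum>e\<in>basis. cinner (S e) y *\<^sub>C e)"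
  have "bounded_linear (\<lambda>y. \<Sum>e\<in>basis. cinner (S e) y *\<^sub>C e)"
    by (intro bounded_linear_sum bounded_linear_scaleC_left[THEN bounded_linear_compose]
        bounded_linear_cinner_right)
  then have R: "R y = (\<Sum>e\<in>basis. cinner (S e) y *\<^sub>C e)" for y
    by (simp add: R_def bounded_linear_Blinfun_apply)
  have R_adj: "cinner (R y) x = cinner y (S x)" for x y
  proof -
    have "cinner (R y) x = (\<Sum>e\<in>basis. cinner y (S e) * cinner e x)"
      unfolding R cinner_sum_left cinner_scaleC_left by (metis cinner_commute)
    also have "\<dots> = cinner y (S (\<Sum>e\<in>basis. cinner e x *\<^sub>C e))"
      using assms
      by (simp add: blinfun.sum_right cinner_sum_right complex_linear_def cinner_scaleC_right
          mult.commute)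
    finally show ?thesis by (simp add: basis_expansion)
  qed
  have "adj S = R"
    unfolding adj_def
  proof (rule the_equality)
    fix R' :: "'k \<Rightarrow>\<^sub>L 'h" assume "\<forall>y x. cinner (R' y) x = cinner y (S x)"
    then show "R' = R" by - (rule blinfun_eqI, rule cinner_left_eqI, simp add: R_adj)
  qed (simp add: R_adj)
  then show ?thesis using R_adj by simp
qed

lemma cinner_adj_right:
  fixes S :: "'h \<Rightarrow>\<^sub>L 'k::chilbert_space"
  assumes "complex_linear S"
  shows "cinner x (adj S y) = cinner (S x) y"
  by (metis assms cinner_adj_left cinner_commute)

text \<open>The trace on the left may be an infinite sum. Expanding each diagonal entry in the
  finite basis of \<open>'h\<close> leaves finitely many series, each summed by Parseval's identity
  in \<open>'k\<close>, which also provides convergence; then \<open>V\<close> drops out of the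
  inner products.\<close>

lemma trace_op_isometry:
  fixes V :: "'h \<Rightarrow>\<^sub>L 'k::chilbert_space" and S :: "'h \<Rightarrow>\<^sub>L 'h"
  assumes V: "isometry_op V" and S: "complex_linear S"
  shows "trace_op (V o\<^sub>L S o\<^sub>L adj V) = trace_op S"
proof -
  have Vc: "complex_linear V" and Vn: "\<And>x. norm (V x) = norm x"
    using V by (auto simp: isometry_op_def)
  \<comment> \<open>Polarization gives the real inner product; applying it to
    \<open>\<i> *\<^sub>C x\<close> gives the complex one.\<close>
  have Vi: "inner (V x) (V y) = inner x y" for x y
    using Vn[of "x + y"] by (simp add: dot_norm blinfun.add_right Vn)
  have VV: "cinner (V x) (V y) = cinner x y" for x y
    using Vc Vi[of "\<i> *\<^sub>C x" y] by (simp add: cinner_eq_Complex Vi complex_linear_def)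
  have "cinner e ((V o\<^sub>L S o\<^sub>L adj V) e) =
      (\<Sum>b\<in>basis. cinner (V (adj S b)) e * cinner e (V b))" for e
  proof -
    have "cinner e ((V o\<^sub>L S o\<^sub>L adj V) e) = cinner (adj V e) (S (adj V e))"
      by (simp add: cinner_adj_left[OF Vc])
    also have "\<dots> = (\<Sum>b\<in>basis. cinner (adj V e) b * cinner b (S (adj V e)))"
      by (simp add: parseval_finite)
    also have "\<dots> = (\<Sum>b\<in>basis. cinner (V (adj S b)) e * cinner e (V b))"
      by (simp add: cinner_adj_left[OF Vc] cinner_adj_left[OF S, symmetric]
          cinner_adj_right[OF Vc] mult.commute)
    finally show ?thesis .
  qed
  moreover have "((\<lambda>e. \<Sum>b\<in>basis. cinner (V (adj S b)) e * cinner e (V b)) has_sum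
      (\<Sum>b\<in>basis. cinner (V (adj S b)) (V b))) basis"
    by (intro has_sum_sum parseval orthonormal_basis_basis)
  ultimately have "trace_op (V o\<^sub>L S o\<^sub>L adj V) = (\<Sum>b\<in>basis. cinner (V (adj S b)) (V b))"
    unfolding trace_op_def basis_def[symmetric] by (simp add: infsumI)
  also have "\<dots> = trace_op S"
    by (simp add: VV cinner_adj_left[OF S] trace_op_eq)
  finally show ?thesis .
qed

lemma trace_op_diff: "trace_op (S - R :: 'h \<Rightarrow>\<^sub>L 'h) = trace_op S - trace_op R"
  by (simp add: trace_op_eq blinfun.diff_left cinner_diff_right sum_subtractf)

lemma trace_op_nonneg:
  fixes S :: "'h \<Rightarrow>\<^sub>L 'h"
  assumes "\<And>u. 0 \<le> cinner u (S u)"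
  shows "0 \<le> trace_op S"
  unfolding trace_op_eq using assms by (intro sum_nonneg)

text \<open>\<open>U o\<^sub>L adj U = id_blinfun\<close> says that \<open>adj U\<close> preserves
  norms. The second claim puts conjugation by \<open>U\<close> into the form
  \<open>V o\<^sub>L K \<alpha> \<beta> o\<^sub>L adj V\<close> with
  \<open>V = adj U\<close>.\<close>

lemma isometry_op_adj_unitary:
  fixes U :: "'h \<Rightarrow>\<^sub>L 'h"
  assumes "unitary_op U"
  shows "isometry_op (adj U)" "adj (adj U) = U"
proof -
  have U: "complex_linear U" "U o\<^sub>L adj U = id_blinfun"
    using assms by (auto simp: unitary_op_def)
  have lin: "complex_linear (adj U)"
    unfolding complex_linear_def
    by (intro allI, rule cinner_left_eqI) (simp add: cinner_adj_left[OF U(1)] cinner_scaleC_left)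
  have "norm (adj U x) = norm x" for x
  proof -
    have "cinner (adj U x) (adj U x) = cinner x ((U o\<^sub>L adj U) x)"
      by (simp add: cinner_adj_left[OF U(1)])
    then have "complex_of_real ((norm (adj U x))\<^sup>2) = complex_of_real ((norm x)\<^sup>2)"
      unfolding U(2) by (simp add: cinner_self)
    then have "(norm (adj U x))\<^sup>2 = (norm x)\<^sup>2" unfolding of_real_eq_iff .
    then show ?thesis by (rule power2_eq_imp_eq) auto
  qed
  with lin show "isometry_op (adj U)" by (auto simp: isometry_op_def)
  show "adj (adj U) = U"
    by (rule blinfun_eqI, rule cinner_left_eqI)
      (simp add: cinner_adj_left[OF lin] cinner_adj_right[OF U(1)])
qed

end

section \<open>Positivity on the diagonal and the free shift\<close>

text \<open>A weak consequence of \<open>pos_def\<close> that is enough for traces: the free shift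
  maps diagonal entries to sums of diagonal entries, and \<open>curvature_seq\<close> reads only the
  entry at the empty word.\<close>

definition diag_nonneg :: "nat \<Rightarrow> 'h::chilbert_space kernel \<Rightarrow> bool" where
  "diag_nonneg d K \<longleftrightarrow> (\<forall>\<alpha>\<in>words d. \<forall>u. 0 \<le> cinner u (K \<alpha> \<alpha> u))"

text \<open>Positive definiteness for families with a single member.\<close>

lemma pos_def_imp_diag_nonneg:
  assumes "pos_def d K"
  shows "diag_nonneg d K"
  unfolding diag_nonneg_def
proof (intro ballI allI)
  fix \<alpha> u assume "\<alpha> \<in> words d"
  then show "0 \<le> cinner u (K \<alpha> \<alpha> u)"
    using assms[unfolded pos_def_def, rule_format, of 1 "\<lambda>_. \<alpha>" "\<lambda>_. u"] by simp
qed

lemma words_snoc: "\<alpha> \<in> words d \<Longrightarrow> i \<in> {1..d} \<Longrightarrow> \<alpha> @ [i] \<in> words d"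
  by (simp add: words_def)

lemma Nil_in_words [simp]: "[] \<in> words d"
  by (simp add: words_def)

lemma diag_nonneg_free_shift_funpow:
  "diag_nonneg d K \<Longrightarrow> diag_nonneg d ((free_shift d ^^ N) K)"
proof (induction N)
  case (Suc N)
  then show ?case
    by (auto simp: diag_nonneg_def free_shift_def blinfun.sum_left cinner_sum_right
        intro!: sum_nonneg words_snoc)
qed simp

text \<open>Supplies the complex linearity that \<open>trace_op_isometry\<close> asks of the
  iterated shift.\<close>

lemma complex_linear_free_shift_funpow:
  assumes "\<And>\<alpha> \<beta>. \<alpha> \<in> words d \<Longrightarrow> \<beta> \<in> words d \<Longrightarrow> complex_linear (K \<alpha> \<beta>)"
    and "\<alpha> \<in> words d" "\<beta> \<in> words d"
  shows "complex_linear ((free_shift d ^^ N) K \<alpha> \<beta>)"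
  using assms(2,3)
proof (induction N arbitrary: \<alpha> \<beta>)
  case (Suc N)
  then have "complex_linear ((free_shift d ^^ N) K (\<alpha> @ [i]) (\<beta> @ [i]))" if "i \<in> {1..d}" for i
    using that by (intro Suc.IH words_snoc)
  moreover have "(free_shift d ^^ Suc N) K \<alpha> \<beta> =
      (\<Sum>i=1..d. (free_shift d ^^ N) K (\<alpha> @ [i]) (\<beta> @ [i]))"
    by (simp add: free_shift_def[of d "(free_shift d ^^ N) K"])
  ultimately show ?case
    by (auto simp: complex_linear_def blinfun.sum_left cvec.scale_sum_right intro!: sum.cong)
qed (simp add: assms(1))

lemma free_shift_funpow_diff:
  "(free_shift d ^^ N) (\<lambda>\<alpha> \<beta>. K \<alpha> \<beta> - L \<alpha> \<beta>) =
    (\<lambda>\<alpha> \<beta>. (free_shift d ^^ N) K \<alpha> \<beta> - (free_shift d ^^ N) L \<alpha> \<beta>)"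
  by (induction N) (simp_all add: free_shift_def sum_subtractf fun_eq_iff)

lemma free_shift_funpow_conj:
  "(free_shift d ^^ N) (\<lambda>\<alpha> \<beta>. V o\<^sub>L K \<alpha> \<beta> o\<^sub>L W) =
    (\<lambda>\<alpha> \<beta>. V o\<^sub>L (free_shift d ^^ N) K \<alpha> \<beta> o\<^sub>L W)"
  by (induction N)
    (auto simp: free_shift_def fun_eq_iff blinfun.sum_left blinfun.sum_right intro!: blinfun_eqI)

lemma complex_linear_word_op:
  assumes "\<And>i. i \<in> {1..d} \<Longrightarrow> complex_linear (A i)" "\<alpha> \<in> words d"
  shows "complex_linear (word_op A \<alpha>)"
  using assms(2) by (induction \<alpha>) (use assms(1) in \<open>auto simp: complex_linear_def words_def\<close>)

section \<open>Moment kernels and the curvature sequence\<close>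

context finite_dim_hilbert
begin

text \<open>For equal words and equal vectors the integrand is the squared norm \<open>f\<close> of
  the adjoint word operator applied to \<open>u\<close>.\<close>

lemma moment_kernel_diag_nonneg:
  assumes "moment_kernel d M (K :: 'h kernel)"
  shows "diag_nonneg d K"
  unfolding diag_nonneg_def
proof (intro ballI allI)
  fix \<alpha> u assume \<alpha>: "\<alpha> \<in> words d"
  obtain A where A: "random_tuple d M A" and
    int: "\<And>\<alpha> u v. \<alpha> \<in> words d \<Longrightarrow> has_bochner_integral M
             (\<lambda>\<omega>. cinner u ((word_op (\<lambda>i. A i \<omega>) \<alpha> o\<^sub>L adj (word_op (\<lambda>i. A i \<omega>) \<alpha>)) v))
             (cinner u (K \<alpha> \<alpha> v))"
    using assms unfolding moment_kernel_def by blast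
  define f where "f \<omega> = (norm (adj (word_op (\<lambda>i. A i \<omega>) \<alpha>) u))\<^sup>2" for \<omega>
  have "cinner u ((word_op (\<lambda>i. A i \<omega>) \<alpha> o\<^sub>L adj (word_op (\<lambda>i. A i \<omega>) \<alpha>)) u) = complex_of_real (f \<omega>)"
    if "\<omega> \<in> space M" for \<omega>
  proof -
    have "complex_linear (word_op (\<lambda>i. A i \<omega>) \<alpha>)"
      using A that \<alpha> by (intro complex_linear_word_op) (auto simp: random_tuple_def)
    then show ?thesis unfolding f_def cinner_self[symmetric] by (simp add: cinner_adj_left)
  qed
  then have int': "has_bochner_integral M (\<lambda>\<omega>. complex_of_real (f \<omega>)) (cinner u (K \<alpha> \<alpha> u))"
    using int[OF \<alpha>, of u u] by (simp cong: has_bochner_integral_cong)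
  have "has_bochner_integral M f (Re (cinner u (K \<alpha> \<alpha> u)))"
    using has_bochner_integral_bounded_linear[OF bounded_linear_Re int'] by simp
  then have "0 \<le> Re (cinner u (K \<alpha> \<alpha> u))"
    using integral_nonneg_AE[of f M] by (auto simp: f_def has_bochner_integral_iff)
  \<comment> \<open>The complex order also demands a vanishing imaginary part, which follows from
    uniqueness of the integral of a real integrand's imaginary part.\<close>
  moreover have "has_bochner_integral M (\<lambda>_. 0) (Im (cinner u (K \<alpha> \<alpha> u)))"
    using has_bochner_integral_bounded_linear[OF bounded_linear_Im int'] by simp
  then have "Im (cinner u (K \<alpha> \<alpha> u)) = 0"
    using has_bochner_integral_eq has_bochner_integral_zero by metis
  ultimately show "0 \<le> cinner u (K \<alpha> \<alpha> u)" by (simp add: less_eq_complex_def)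
qed

lemma curvature_seq_nonneg: "diag_nonneg d (K :: 'h kernel) \<Longrightarrow> 0 \<le> curvature_seq d K N"
  unfolding curvature_seq_def using diag_nonneg_free_shift_funpow[of d K N]
  by (intro trace_op_nonneg) (simp add: diag_nonneg_def)

lemma curvature_seq_diff:
  "curvature_seq d (\<lambda>\<alpha> \<beta>. (K :: 'h kernel) \<alpha> \<beta> - L \<alpha> \<beta>) N = curvature_seq d K N - curvature_seq d L N"
  by (simp add: curvature_seq_def free_shift_funpow_diff trace_op_diff)

text \<open>Nonnegative traces of the shifted defect make the sequence decreasing, and nonnegative
  traces of the shifted kernel bound it below.\<close>

lemma curvature_seq_convergent:
  assumes "diag_nonneg d (K :: 'h kernel)" "diag_nonneg d (first_defect d K)"
  shows "convergent (curvature_seq d K)"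
proof -
  \<comment> \<open>By linearity of the iterated shift; \<open>funpow_swap1\<close> identifies the
    iterate \<open>N\<close> of \<open>free_shift d K\<close> with the iterate \<open>Suc N\<close>
    of \<open>K\<close>.\<close>
  have "curvature_seq d (first_defect d K) N = curvature_seq d K N - curvature_seq d K (Suc N)" for N
    unfolding first_defect_def curvature_seq_diff by (simp add: curvature_seq_def funpow_swap1)
  then have "curvature_seq d K (Suc N) \<le> curvature_seq d K N" for N
    using curvature_seq_nonneg[OF assms(2), of N] by simp
  \<comment> \<open>Monotone convergence is applied to the real parts; the imaginary parts vanish,
    so the real limit lifts back.\<close>
  then have "decseq (\<lambda>N. Re (curvature_seq d K N))"
    by (intro decseq_SucI) (simp add: less_eq_complex_def)
  moreover have nn: "0 \<le> Re (curvature_seq d K N)" "Im (curvature_seq d K N) = 0" for N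
    using curvature_seq_nonneg[OF assms(1), of N] by (auto simp: less_eq_complex_def)
  ultimately obtain l where "(\<lambda>N. Re (curvature_seq d K N)) \<longlonglongrightarrow> l"
    using decseq_convergent by blast
  then have "(\<lambda>N. complex_of_real (Re (curvature_seq d K N))) \<longlonglongrightarrow> complex_of_real l"
    by (rule tendsto_of_real)
  moreover have "complex_of_real (Re (curvature_seq d K N)) = curvature_seq d K N" for N
    using nn by (simp add: complex_eq_iff)
  ultimately show ?thesis by (auto simp: convergent_def)
qed

text \<open>The traces of the iterates are ordered for every \<open>N\<close>, and the order passes
  to the limits. Convergence is assumed because only then is \<open>lim\<close> known to be the
  limit.\<close>

lemma curvature_mono:
  assumes "convergent (curvature_seq d K)" "convergent (curvature_seq d L)"
    and "kernel_le d (L :: 'h kernel) K"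
  shows "curvature d L \<le> curvature d K"
proof -
  have lim: "curvature_seq d K \<longlonglongrightarrow> curvature d K" "curvature_seq d L \<longlonglongrightarrow> curvature d L"
    using assms by (simp_all add: curvature_def convergent_LIMSEQ_iff)
  have le: "curvature_seq d L N \<le> curvature_seq d K N" for N
    using curvature_seq_nonneg[OF pos_def_imp_diag_nonneg[OF assms(3)[unfolded kernel_le_def]], of N]
    by (simp add: curvature_seq_diff)
  have "Re (curvature d L) \<le> Re (curvature d K)"
    using le by (intro LIMSEQ_le[OF tendsto_Re[OF lim(2)] tendsto_Re[OF lim(1)]])
      (auto simp: less_eq_complex_def)
  \<comment> \<open>Order on complex numbers forces equal imaginary parts at every \<open>N\<close>,
    hence in the limit.\<close>
  moreover have "Im (curvature d L) = Im (curvature d K)"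
  proof (rule LIMSEQ_unique)
    show "(\<lambda>N. Im (curvature_seq d L N)) \<longlonglongrightarrow> Im (curvature d L)" using lim(2) by (rule tendsto_Im)
    have "Im (curvature_seq d L N) = Im (curvature_seq d K N)" for N
      using le[of N] by (simp add: less_eq_complex_def)
    then show "(\<lambda>N. Im (curvature_seq d L N)) \<longlonglongrightarrow> Im (curvature d K)"
      using tendsto_Im[OF lim(1)] by simp
  qed
  ultimately show ?thesis by (simp add: less_eq_complex_def)
qed

text \<open>Equality holds at every \<open>N\<close>, so convergence and the value of the limit
  transfer together.\<close>

lemma curvature_seq_isometry:
  fixes V :: "'h \<Rightarrow>\<^sub>L 'k::chilbert_space"
  assumes "moment_kernel d M K" "isometry_op V"
  shows "curvature_seq d (\<lambda>\<alpha> \<beta>. V o\<^sub>L K \<alpha> \<beta> o\<^sub>L adj V) = curvature_seq d K"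
proof
  fix N
  have "complex_linear ((free_shift d ^^ N) K [] [])"
    using assms(1) by (intro complex_linear_free_shift_funpow) (auto simp: moment_kernel_def)
  then show "curvature_seq d (\<lambda>\<alpha> \<beta>. V o\<^sub>L K \<alpha> \<beta> o\<^sub>L adj V) N = curvature_seq d K N"
    using trace_op_isometry[OF assms(2)] by (simp add: curvature_seq_def free_shift_funpow_conj)
qed

end

text \<open>Convergence is part of the conclusion, so that every curvature compared is a genuine
  limit. The two kernels may come from different probability spaces.\<close>

theorem proposition6p6:
  fixes d :: nat
    and M1 :: "'w1 measure" and M2 :: "'w2 measure"
    and K L :: "'h::chilbert_space kernel"
  assumes finite_dim: "\<exists>B :: 'h set. finite B \<and> cvec.span B = UNIV"
    and K: "moment_kernel d M1 K" and L: "moment_kernel d M2 L"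
    and K_unit: "K [] [] = id_blinfun" and L_unit: "L [] [] = id_blinfun"
    and K_defect: "pos_def d (first_defect d K)" and L_defect: "pos_def d (first_defect d L)"
  shows "convergent (curvature_seq d K) \<and> convergent (curvature_seq d L) \<and>
    (pos_def d L \<and> kernel_le d L K \<longrightarrow> curvature d L \<le> curvature d K) \<and>
    (\<forall>U :: 'h \<Rightarrow>\<^sub>L 'h. unitary_op U \<longrightarrow>
       (let KU = (\<lambda>\<alpha> \<beta>. adj U o\<^sub>L K \<alpha> \<beta> o\<^sub>L U)
        in convergent (curvature_seq d KU) \<and> curvature d KU = curvature d K)) \<and>
    (\<forall>V :: 'h \<Rightarrow>\<^sub>L 'k::chilbert_space. isometry_op V \<longrightarrow>
       (let K' = (\<lambda>\<alpha> \<beta>. V o\<^sub>L K \<alpha> \<beta> o\<^sub>L adj V)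
        in convergent (curvature_seq d K') \<and> curvature d K' = curvature d K))"
proof -
  interpret finite_dim_hilbert "TYPE('h)"
    by standard (rule finite_dim)
  have conv: "convergent (curvature_seq d K)" "convergent (curvature_seq d L)"
    using moment_kernel_diag_nonneg[OF K] moment_kernel_diag_nonneg[OF L]
      pos_def_imp_diag_nonneg[OF K_defect] pos_def_imp_diag_nonneg[OF L_defect]
    by (auto intro: curvature_seq_convergent)
  have "curvature_seq d (\<lambda>\<alpha> \<beta>. adj U o\<^sub>L K \<alpha> \<beta> o\<^sub>L U) = curvature_seq d K" if "unitary_op U" for U
    using curvature_seq_isometry[OF K isometry_op_adj_unitary(1)[OF that]]
    by (simp add: isometry_op_adj_unitary(2)[OF that])
  moreover have "curvature_seq d (\<lambda>\<alpha> \<beta>. V o\<^sub>L K \<alpha> \<beta> o\<^sub>L adj V) = curvature_seq d K"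
    if "isometry_op V" for V :: "'h \<Rightarrow>\<^sub>L 'k"
    using curvature_seq_isometry[OF K that] .
  ultimately show ?thesis
    using conv curvature_mono[OF conv] by (simp add: Let_def curvature_def)
qed

end
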